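(* Let $D$ be the Levi-Civita covariant derivative of the Wasserstein Riemannian metric on $\operatorname{Sym}^{++}(n)$. For smooth vector fields $X,Y,Z$ on $\operatorname{Sym}^{++}(n)$, the vector field $D_XY$ is implicitly defined by $$\begin{aligned}\langle D_XY,Z\rangle_\Sigma&=\langle d_XY,Z\rangle_\Sigma+\langle X,\{\mathcal L_\Sigma[Y]Z\}_S\rangle_\Sigma-\langle X,\{\mathcal L_\Sigma[Z]Y\}_S\rangle_\Sigma-\langle Y,\{\mathcal L_\Sigma[Z]X\}_S\rangle_\Sigma\\&=\langle d_XY,Z\rangle_\Sigma+\tfrac12\operatorname{Tr}\left(\mathcal L_\Sigma[X]Z\mathcal L_\Sigma[Y]\right)-\tfrac12\operatorname{Tr}\left(\mathcal L_\Sigma[X]Y\mathcal L_\Sigma[Z]\right)-\tfrac12\operatorname{Tr}\left(\mathcal L_\Sigma[Y]X\mathcal L_\Sigma[Z]\right),\end{aligned}$$ while the Levi-Civita derivative itself is given by $$D_XY=d_XY-\{\mathcal L_\Sigma[X]Y+\mathcal L_\Sigma[Y]X\}_S+\{\Sigma\mathcal L_\Sigma[X]\mathcal L_\Sigma[Y]+\Sigma\mathcal L_\Sigma[Y]\mathcal L_\Sigma[X]\}_S .$$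
   Context: $\operatorname{Sym}(n)$ is the space of real symmetric $n\times n$ matrices, $\operatorname{Sym}^{++}(n)$ the open cone of positive-definite ones. For $\Sigma\in\operatorname{Sym}^{++}(n)$ and $V\in\operatorname{Sym}(n)$, $\mathcal L_\Sigma[V]$ is the unique $X\in\operatorname{Sym}(n)$ with $X\Sigma+\Sigma X=V$. The Wasserstein Riemannian metric is $\langle U,V\rangle_\Sigma=W_\Sigma(U,V)=\operatorname{Tr}(\mathcal L_\Sigma[U]\Sigma\mathcal L_\Sigma[V])=\frac12\operatorname{Tr}(\mathcal L_\Sigma[U]V)$. For a square matrix $A$, $\{A\}_S=\frac12(A+A^* )$. In the trivial chart a smooth vector field is a smooth map $X\colon\operatorname{Sym}^{++}(n)\to\operatorname{Sym}(n)$, and $d_XY$ is the vector field whose value at $\Sigma$ is the ordinary derivative of $Y$ at $\Sigma$ in the direction $X(\Sigma)$; in the formulas $X,Y,Z$ are evaluated at $\Sigma$. The Levi-Civita derivative is the unique covariant derivative $D$ that is compatible with the metric and torsion-free, i.e. $D_XY-D_YX=d_XY-d_YX$. *)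

theory Defs
  imports "HOL-Analysis.Analysis"
begin

definition Sym :: "(real^'n^'n) set" where
  "Sym = {A. transpose A = A}"

definition SPD :: "(real^'n^'n) set" where
  "SPD = {A \<in> Sym. \<forall>x. x \<noteq> 0 \<longrightarrow> x \<bullet> (A *v x) > 0}"

definition sym_part :: "real^'n^'n \<Rightarrow> real^'n^'n" where
  "sym_part A = (1/2) *\<^sub>R (A + transpose A)"

text \<open>\<open>lyap \<Sigma> V\<close> is well defined for \<open>\<Sigma> \<in> SPD\<close> and \<open>V \<in> Sym\<close>, and unspecified otherwise.\<close>

definition lyap :: "real^'n^'n \<Rightarrow> real^'n^'n \<Rightarrow> real^'n^'n" where
  "lyap \<Sigma> V = (THE X. X \<in> Sym \<and> X ** \<Sigma> + \<Sigma> ** X = V)"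

definition wass :: "real^'n^'n \<Rightarrow> real^'n^'n \<Rightarrow> real^'n^'n \<Rightarrow> real" where
  "wass \<Sigma> U V = trace (lyap \<Sigma> U ** \<Sigma> ** lyap \<Sigma> V)"

text \<open>
  Functions and vector fields on the manifold \<open>SPD\<close> are represented by total functions on all
  square matrices; only their values on \<open>SPD\<close> matter. The set \<open>SPD\<close> is open in the
  linear space \<open>Sym\<close> but not in the space of all square matrices, so derivatives are taken
  within \<open>SPD\<close> and in symmetric directions only. For \<open>\<Sigma> \<in> SPD\<close> and \<open>V \<in> Sym\<close> the curve
  \<open>t \<mapsto> \<Sigma> + t V\<close> stays in \<open>SPD\<close> for small \<open>t\<close>.
\<close>

definition dir_deriv ::
  "(real^'n^'n \<Rightarrow> 'b::real_normed_vector) \<Rightarrow> real^'n^'n \<Rightarrow> real^'n^'n \<Rightarrow> 'b" where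
  "dir_deriv f \<Sigma> V = vector_derivative (\<lambda>t. f (\<Sigma> + t *\<^sub>R V)) (at 0)"

primrec Ck_on_SPD :: "nat \<Rightarrow> (real^'n^'n \<Rightarrow> 'b::real_normed_vector) \<Rightarrow> bool" where
  "Ck_on_SPD 0 f \<longleftrightarrow> continuous_on SPD f"
| "Ck_on_SPD (Suc k) f \<longleftrightarrow>
     (\<forall>\<Sigma>\<in>SPD. f differentiable (at \<Sigma> within SPD)) \<and>
     (\<forall>V\<in>Sym. Ck_on_SPD k (\<lambda>\<Sigma>. dir_deriv f \<Sigma> V))"

definition smooth_on_SPD :: "(real^'n^'n \<Rightarrow> 'b::real_normed_vector) \<Rightarrow> bool" where
  "smooth_on_SPD f \<longleftrightarrow> (\<forall>k. Ck_on_SPD k f)"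

definition vector_field :: "(real^'n^'n \<Rightarrow> real^'n^'n) \<Rightarrow> bool" where
  "vector_field X \<longleftrightarrow> (\<forall>\<Sigma>\<in>SPD. X \<Sigma> \<in> Sym) \<and> smooth_on_SPD X"

definition dfield ::
  "(real^'n^'n \<Rightarrow> real^'n^'n) \<Rightarrow> (real^'n^'n \<Rightarrow> 'b::real_normed_vector) \<Rightarrow> real^'n^'n \<Rightarrow> 'b" where
  "dfield X f \<Sigma> = dir_deriv f \<Sigma> (X \<Sigma>)"

definition eq_on_SPD :: "(real^'n^'n \<Rightarrow> 'b) \<Rightarrow> (real^'n^'n \<Rightarrow> 'b) \<Rightarrow> bool" where
  "eq_on_SPD f g \<longleftrightarrow> (\<forall>\<Sigma>\<in>SPD. f \<Sigma> = g \<Sigma>)"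

text \<open>
  The first two conditions say that \<open>D\<close> is a well-defined operation on vector fields;
  the remaining ones are linearity over smooth functions in the first argument,
  additivity and the Leibniz rule in the second. Real homogeneity in the second argument
  is the Leibniz rule for constant \<open>f\<close>.
\<close>

definition covariant_derivative ::
  "((real^'n^'n \<Rightarrow> real^'n^'n) \<Rightarrow> (real^'n^'n \<Rightarrow> real^'n^'n) \<Rightarrow> (real^'n^'n \<Rightarrow> real^'n^'n)) \<Rightarrow> bool" where
  "covariant_derivative D \<longleftrightarrow>
     (\<forall>X Y. vector_field X \<longrightarrow> vector_field Y \<longrightarrow> vector_field (D X Y)) \<and>
     (\<forall>X X' Y Y'. vector_field X \<longrightarrow> vector_field X' \<longrightarrow> vector_field Y \<longrightarrow> vector_field Y' \<longrightarrow>
        eq_on_SPD X X' \<longrightarrow> eq_on_SPD Y Y' \<longrightarrow> eq_on_SPD (D X Y) (D X' Y')) \<and>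
     (\<forall>X X' Y. vector_field X \<longrightarrow> vector_field X' \<longrightarrow> vector_field Y \<longrightarrow>
        eq_on_SPD (D (\<lambda>\<Sigma>. X \<Sigma> + X' \<Sigma>) Y) (\<lambda>\<Sigma>. D X Y \<Sigma> + D X' Y \<Sigma>)) \<and>
     (\<forall>(f :: real^'n^'n \<Rightarrow> real) X Y. smooth_on_SPD f \<longrightarrow> vector_field X \<longrightarrow> vector_field Y \<longrightarrow>
        eq_on_SPD (D (\<lambda>\<Sigma>. f \<Sigma> *\<^sub>R X \<Sigma>) Y) (\<lambda>\<Sigma>. f \<Sigma> *\<^sub>R D X Y \<Sigma>)) \<and>
     (\<forall>X Y Y'. vector_field X \<longrightarrow> vector_field Y \<longrightarrow> vector_field Y' \<longrightarrow>
        eq_on_SPD (D X (\<lambda>\<Sigma>. Y \<Sigma> + Y' \<Sigma>)) (\<lambda>\<Sigma>. D X Y \<Sigma> + D X Y' \<Sigma>)) \<and>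
     (\<forall>(f :: real^'n^'n \<Rightarrow> real) X Y. smooth_on_SPD f \<longrightarrow> vector_field X \<longrightarrow> vector_field Y \<longrightarrow>
        eq_on_SPD (D X (\<lambda>\<Sigma>. f \<Sigma> *\<^sub>R Y \<Sigma>))
          (\<lambda>\<Sigma>. f \<Sigma> *\<^sub>R D X Y \<Sigma> + dfield X f \<Sigma> *\<^sub>R Y \<Sigma>))"

definition metric_compatible ::
  "((real^'n^'n \<Rightarrow> real^'n^'n) \<Rightarrow> (real^'n^'n \<Rightarrow> real^'n^'n) \<Rightarrow> (real^'n^'n \<Rightarrow> real^'n^'n)) \<Rightarrow> bool" where
  "metric_compatible D \<longleftrightarrow>
     (\<forall>X Y Z. vector_field X \<longrightarrow> vector_field Y \<longrightarrow> vector_field Z \<longrightarrow>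
        eq_on_SPD (dfield X (\<lambda>\<Sigma>. wass \<Sigma> (Y \<Sigma>) (Z \<Sigma>)))
          (\<lambda>\<Sigma>. wass \<Sigma> (D X Y \<Sigma>) (Z \<Sigma>) + wass \<Sigma> (Y \<Sigma>) (D X Z \<Sigma>)))"

definition torsion_free ::
  "((real^'n^'n \<Rightarrow> real^'n^'n) \<Rightarrow> (real^'n^'n \<Rightarrow> real^'n^'n) \<Rightarrow> (real^'n^'n \<Rightarrow> real^'n^'n)) \<Rightarrow> bool" where
  "torsion_free D \<longleftrightarrow>
     (\<forall>X Y. vector_field X \<longrightarrow> vector_field Y \<longrightarrow>
        eq_on_SPD (\<lambda>\<Sigma>. D X Y \<Sigma> - D Y X \<Sigma>) (\<lambda>\<Sigma>. dfield X Y \<Sigma> - dfield Y X \<Sigma>))"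

definition levi_civita ::
  "((real^'n^'n \<Rightarrow> real^'n^'n) \<Rightarrow> (real^'n^'n \<Rightarrow> real^'n^'n) \<Rightarrow> (real^'n^'n \<Rightarrow> real^'n^'n)) \<Rightarrow> bool" where
  "levi_civita D \<longleftrightarrow> covariant_derivative D \<and> metric_compatible D \<and> torsion_free D"

end

theory Submission
  imports Defs
begin

text \<open>
  Write \<open>L\<^sub>U\<close> for \<open>lyap \<Sigma> U\<close>. The operator \<open>X \<mapsto> X \<Sigma> + \<Sigma> X\<close> is injective because
  \<open>Tr (X\<^sup>T (X \<Sigma> + \<Sigma> X)) = Tr (X \<Sigma> X\<^sup>T) + Tr (X\<^sup>T \<Sigma> X)\<close> is a sum of values of a positive definite
  form; in finite dimension it is therefore bijective, so \<open>L\<^sub>U\<close> exists, is symmetric and depends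
  linearly on \<open>U\<close>. Since \<open>\<langle>U,V\<rangle>\<^sub>\<Sigma> = Tr (L\<^sub>U V) / 2\<close>, the metric is a nondegenerate
  symmetric form on symmetric matrices (\<open>wass_eq_half_trace\<close>, \<open>wass_nondegenerate\<close>).

  The only analytic input is the derivative of the metric. Differentiating the Lyapunov equation
  along \<open>\<Sigma> + t X\<close> shows that the derivative of \<open>L\<^sub>V\<close> is \<open>lyap \<Sigma> (V' - L\<^sub>V X - X L\<^sub>V)\<close>
  (\<open>lyap_has_vector_derivative\<close>), and hence, for vector fields \<open>Y\<close> and \<open>Z\<close>,
  \<open>d\<^sub>X \<langle>Y,Z\<rangle> = \<langle>d\<^sub>X Y,Z\<rangle> + \<langle>Y,d\<^sub>X Z\<rangle> - Tr (L\<^sub>Y X L\<^sub>Z)\<close> (\<open>dfield_wass\<close>).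

  Now let \<open>e(X,Y) = D\<^sub>X Y - d\<^sub>X Y\<close>. Absence of torsion says that \<open>e\<close> is symmetric, and
  compatibility says that \<open>\<langle>e(X,Y),Z\<rangle> + \<langle>Y,e(X,Z)\<rangle> = - Tr (L\<^sub>Y X L\<^sub>Z)\<close>. Adding two cyclic
  permutations of this identity and subtracting the third isolates \<open>\<langle>e(X,Y),Z\<rangle>\<close>, which is
  Koszul's argument (\<open>koszul_wass\<close>). The remaining forms of the answer are rewritings of
  \<open>Tr (L\<^sub>X Z L\<^sub>Y)\<close>, \<open>Tr (L\<^sub>X Y L\<^sub>Z)\<close> and \<open>Tr (L\<^sub>Y X L\<^sub>Z)\<close> as inner products with \<open>Z\<close>; the
  first one needs the Lyapunov equation \<open>Z = L\<^sub>Z \<Sigma> + \<Sigma> L\<^sub>Z\<close> to move \<open>L\<^sub>Z\<close> out of the middle,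
  which is where the factor \<open>\<Sigma>\<close> in the explicit formula comes from.
\<close>

section \<open>Traces and symmetric matrices\<close>

lemma bounded_bilinear_matrix_mult:
  "bounded_bilinear ((**) :: real^'n^'n \<Rightarrow> real^'n^'n \<Rightarrow> real^'n^'n)"
  by (rule bilinear_conv_bounded_bilinear[THEN iffD1], unfold bilinear_def, intro conjI allI linearI)
     (vector matrix_matrix_mult_def sum.distrib algebra_simps sum_distrib_left)+

interpretation mm: bounded_bilinear "(**) :: real^'n^'n \<Rightarrow> real^'n^'n \<Rightarrow> real^'n^'n"
  by (rule bounded_bilinear_matrix_mult)

lemma transpose_add: "transpose (A + B) = transpose A + transpose (B :: real^'n^'m)"
  by (simp add: transpose_def vec_eq_iff)

lemma bounded_linear_transpose: "bounded_linear (transpose :: real^'n^'n \<Rightarrow> real^'n^'n)"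
  by (rule linear_conv_bounded_linear[THEN iffD1], rule linearI)
     (simp_all add: transpose_add transpose_scalar)

lemma bounded_linear_trace: "bounded_linear (trace :: real^'n^'n \<Rightarrow> real)"
  by (rule linear_conv_bounded_linear[THEN iffD1], rule linearI)
     (simp_all add: trace_add, simp add: trace_def sum_distrib_left)

lemmas trace_zero = linear_0[OF bounded_linear.linear[OF bounded_linear_trace]]
lemmas trace_scaleR = linear_cmul[OF bounded_linear.linear[OF bounded_linear_trace]]

lemma bounded_linear_sym_part: "bounded_linear (sym_part :: real^'n^'n \<Rightarrow> real^'n^'n)"
  unfolding sym_part_def
  by (intro bounded_linear_scaleR_right[THEN bounded_linear_compose]
      bounded_linear_add bounded_linear_ident bounded_linear_transpose)

lemma subspace_Sym: "subspace (Sym :: (real^'n^'n) set)"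
  unfolding subspace_def Sym_def by (simp add: transpose_add transpose_scalar)
    (simp add: transpose_def vec_eq_iff)

lemmas Sym_add = subspace_add[OF subspace_Sym]
lemmas Sym_diff = subspace_diff[OF subspace_Sym]
lemmas Sym_scaleR = subspace_scale[OF subspace_Sym]

lemma SymD: "A \<in> Sym \<Longrightarrow> transpose A = A"
  by (simp add: Sym_def)

lemma sym_part_Sym: "sym_part A \<in> Sym"
  by (simp add: Sym_def sym_part_def transpose_scalar transpose_add add.commute)

lemma sym_part_ident: "A \<in> Sym \<Longrightarrow> sym_part A = A"
  by (simp add: Sym_def sym_part_def flip: scaleR_2)

lemma trace_transpose: "trace (transpose A) = trace (A :: real^'n^'n)"
  by (simp add: trace_def transpose_def)

lemma trace_cycle3: "trace (A ** B ** C) = trace (B ** C ** (A :: real^'n^'n))"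
  by (metis trace_mul_sym matrix_mul_assoc)

lemma trace_reverse3:
  assumes "A \<in> Sym" "B \<in> Sym" "C \<in> Sym"
  shows "trace (A ** B ** C) = trace (C ** B ** (A :: real^'n^'n))"
  using assms trace_transpose[of "A ** B ** C"]
  by (simp add: matrix_transpose_mul SymD matrix_mul_assoc)

lemma trace_mult_sym_part:
  assumes "A \<in> Sym"
  shows "trace (A ** sym_part B) = trace (A ** (B :: real^'n^'n))"
proof -
  have "trace (A ** transpose B) = trace (A ** B)"
    using trace_transpose[of "A ** transpose B"] trace_mul_sym[of B A]
    by (simp add: matrix_transpose_mul SymD[OF assms])
  then show ?thesis
    by (simp add: sym_part_def mm.scaleR_right mm.add_right trace_scaleR trace_add)
qed

lemma trace_transpose_mult_self_eq_0:
  assumes "trace (transpose A ** A) = 0"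
  shows "A = (0 :: real^'n^'n)"
proof -
  have "trace (transpose A ** A) = (\<Sum>i\<in>UNIV. \<Sum>k\<in>UNIV. (A $ k $ i)\<^sup>2)"
    by (simp add: trace_def matrix_matrix_mult_def transpose_def power2_eq_square)
  then have "\<forall>i k. A $ k $ i = 0"
    using assms by (simp add: sum_nonneg_eq_0_iff sum_nonneg)
  then show ?thesis
    by (simp add: vec_eq_iff)
qed

section \<open>The Lyapunov equation\<close>

lemma SPD_Sym: "\<Sigma> \<in> SPD \<Longrightarrow> \<Sigma> \<in> Sym"
  by (simp add: SPD_def)

lemma trace_congruence:
  fixes S :: "real^'n^'n" and A :: "real^'m^'n"
  shows "trace (transpose A ** S ** A) = (\<Sum>i\<in>UNIV. column i A \<bullet> (S *v column i A))"
proof -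
  have "(transpose A ** S ** A) $ i $ i = column i A \<bullet> (S *v column i A)" for i
    unfolding matrix_mul_assoc[symmetric]
    by (simp add: matrix_matrix_mult_def transpose_def matrix_vector_mult_def column_def
        inner_vec_def)
  then show ?thesis
    by (simp add: trace_def)
qed

lemma SPD_quadratic_nonneg: "\<Sigma> \<in> SPD \<Longrightarrow> x \<bullet> (\<Sigma> *v x) \<ge> 0"
  by (cases "x = 0") (auto simp: SPD_def intro: less_imp_le)

lemma trace_congruence_nonneg:
  "\<Sigma> \<in> SPD \<Longrightarrow> trace (transpose A ** \<Sigma> ** A) \<ge> 0"
  unfolding trace_congruence by (intro sum_nonneg SPD_quadratic_nonneg)

lemma trace_congruence_eq_0:
  assumes "\<Sigma> \<in> SPD" and "trace (transpose A ** \<Sigma> ** A) = 0"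
  shows "A = 0"
proof -
  have "\<forall>i. column i A \<bullet> (\<Sigma> *v column i A) = 0"
    using assms by (simp add: trace_congruence sum_nonneg_eq_0_iff SPD_quadratic_nonneg)
  then have "\<forall>i. column i A = 0"
    using assms(1) by (force simp: SPD_def)
  then show ?thesis
    by (simp add: vec_eq_iff column_def)
qed

text \<open>
  Pairing the equation with \<open>X\<close> itself leaves two nonnegative terms, both of which must vanish.
  Injectivity on the whole matrix space, rather than on symmetric matrices alone, makes the operator
  an injective endomorphism of one finite-dimensional space and hence surjective.
\<close>

lemma lyapunov_homogeneous:
  assumes S: "\<Sigma> \<in> SPD" and eq: "X ** \<Sigma> + \<Sigma> ** X = 0"
  shows "X = 0"
proof -
  have "trace (transpose X ** (X ** \<Sigma> + \<Sigma> ** X)) = 0"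
    by (simp add: eq mm.zero_right trace_zero)
  moreover have "trace (transpose X ** (X ** \<Sigma>)) = trace (X ** \<Sigma> ** transpose X)"
    by (rule trace_mul_sym)
  ultimately have "trace (X ** \<Sigma> ** transpose X) + trace (transpose X ** \<Sigma> ** X) = 0"
    by (simp add: mm.add_right trace_add matrix_mul_assoc)
  moreover have "trace (X ** \<Sigma> ** transpose X) \<ge> 0"
    using trace_congruence_nonneg[OF S, of "transpose X"] by simp
  ultimately have "trace (transpose X ** \<Sigma> ** X) = 0"
    using trace_congruence_nonneg[OF S, of X] by linarith
  then show ?thesis
    by (rule trace_congruence_eq_0[OF S])
qed

lemma lyapunov_unique:
  assumes "\<Sigma> \<in> SPD" and "X ** \<Sigma> + \<Sigma> ** X = V" and "X' ** \<Sigma> + \<Sigma> ** X' = V"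
  shows "X = X'"
proof -
  have "(X - X') ** \<Sigma> + \<Sigma> ** (X - X') = 0"
    using assms(2,3) by (simp add: mm.diff_left mm.diff_right algebra_simps)
  from lyapunov_homogeneous[OF assms(1) this] show ?thesis
    by simp
qed

text \<open>
  Solvability is injectivity in finite dimension; the solution is symmetric because its
  transpose solves the same equation.
\<close>

lemma lyapunov_exists:
  assumes S: "\<Sigma> \<in> SPD" and V: "V \<in> Sym"
  shows "\<exists>X\<in>Sym. X ** \<Sigma> + \<Sigma> ** X = V"
proof -
  let ?f = "\<lambda>X. X ** \<Sigma> + \<Sigma> ** X"
  have "linear ?f"
    by (intro linearI)
       (simp_all add: mm.add_left mm.add_right mm.scaleR_left mm.scaleR_right algebra_simps)
  moreover have "inj ?f"
    by (rule injI) (rule lyapunov_unique[OF S _ refl])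
  ultimately have "surj ?f"
    by (intro linear_injective_imp_surjective) simp_all
  then obtain X where "V = ?f X"
    by (rule surjE)
  then have X: "?f X = V"
    by (rule sym)
  have "transpose (?f X) = ?f (transpose X)"
    by (simp add: transpose_add matrix_transpose_mul SymD[OF SPD_Sym[OF S]] add.commute)
  then have "?f (transpose X) = V"
    using X SymD[OF V] by simp
  from lyapunov_unique[OF S this X] have "X \<in> Sym"
    by (simp add: Sym_def)
  with X show ?thesis
    by blast
qed

lemma lyap_eqI:
  assumes "\<Sigma> \<in> SPD" "X \<in> Sym" "X ** \<Sigma> + \<Sigma> ** X = V"
  shows "lyap \<Sigma> V = X"
  unfolding lyap_def
proof (rule the_equality)
  show "X \<in> Sym \<and> X ** \<Sigma> + \<Sigma> ** X = V"
    using assms by simp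
  show "X' = X" if "X' \<in> Sym \<and> X' ** \<Sigma> + \<Sigma> ** X' = V" for X'
    using lyapunov_unique[OF assms(1) _ assms(3)] that by blast
qed

lemma
  assumes "\<Sigma> \<in> SPD" "V \<in> Sym"
  shows lyap_Sym: "lyap \<Sigma> V \<in> Sym"
    and lyap_equation: "lyap \<Sigma> V ** \<Sigma> + \<Sigma> ** lyap \<Sigma> V = V"
proof -
  obtain X where "X \<in> Sym" "X ** \<Sigma> + \<Sigma> ** X = V"
    using lyapunov_exists[OF assms] by blast
  moreover from this have "lyap \<Sigma> V = X"
    by (rule lyap_eqI[OF assms(1)])
  ultimately show "lyap \<Sigma> V \<in> Sym" "lyap \<Sigma> V ** \<Sigma> + \<Sigma> ** lyap \<Sigma> V = V"
    by simp_all
qed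

lemma lyap_add:
  assumes "\<Sigma> \<in> SPD" "U \<in> Sym" "V \<in> Sym"
  shows "lyap \<Sigma> (U + V) = lyap \<Sigma> U + lyap \<Sigma> V"
  using assms lyap_equation[of \<Sigma> U] lyap_equation[of \<Sigma> V]
  by (intro lyap_eqI[where \<Sigma> = \<Sigma>])
     (auto intro: Sym_add lyap_Sym simp: mm.add_left mm.add_right algebra_simps)

lemma lyap_scaleR:
  assumes "\<Sigma> \<in> SPD" "V \<in> Sym"
  shows "lyap \<Sigma> (c *\<^sub>R V) = c *\<^sub>R lyap \<Sigma> V"
  using assms lyap_equation[of \<Sigma> V]
  by (intro lyap_eqI[where \<Sigma> = \<Sigma>])
     (auto intro: Sym_scaleR lyap_Sym simp: mm.scaleR_left mm.scaleR_right simp flip: scaleR_add_right)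

text \<open>
  Precomposition with the symmetric part makes the solution operator total and linear on the
  whole matrix space, so that the calculus of bounded linear maps applies to it.
\<close>

lemma bounded_linear_lyap_sym_part:
  assumes "\<Sigma> \<in> SPD"
  shows "bounded_linear (\<lambda>A. lyap \<Sigma> (sym_part A))"
proof -
  interpret sp: bounded_linear "sym_part :: real^'n^'n \<Rightarrow> real^'n^'n"
    by (rule bounded_linear_sym_part)
  show ?thesis
    by (intro linear_conv_bounded_linear[THEN iffD1] linearI)
       (simp_all add: sp.add sp.scaleR lyap_add lyap_scaleR assms sym_part_Sym)
qed

section \<open>The Wasserstein form\<close>

lemma wass_eq_half_trace:
  assumes S: "\<Sigma> \<in> SPD" and U: "U \<in> Sym" and V: "V \<in> Sym"
  shows "wass \<Sigma> U V = trace (lyap \<Sigma> U ** V) / 2"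
proof -
  let ?K = "lyap \<Sigma> U" and ?L = "lyap \<Sigma> V"
  have K: "?K \<in> Sym" and L: "?L \<in> Sym"
    using S U V by (simp_all add: lyap_Sym)
  have "trace (?K ** V) = trace (?K ** (?L ** \<Sigma> + \<Sigma> ** ?L))"
    by (simp add: lyap_equation[OF S V])
  also have "\<dots> = trace (?K ** ?L ** \<Sigma>) + trace (?K ** \<Sigma> ** ?L)"
    by (simp add: mm.add_right trace_add matrix_mul_assoc)
  also have "trace (?K ** ?L ** \<Sigma>) = trace (?K ** \<Sigma> ** ?L)"
    using trace_reverse3[OF K L SPD_Sym[OF S]] trace_cycle3[of ?K \<Sigma> ?L] by simp
  finally show ?thesis
    by (simp add: wass_def)
qed

lemma wass_sym:
  assumes "\<Sigma> \<in> SPD" "U \<in> Sym" "V \<in> Sym"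
  shows "wass \<Sigma> U V = wass \<Sigma> V U"
  unfolding wass_def using assms by (intro trace_reverse3) (simp_all add: lyap_Sym SPD_Sym)

lemma wass_add_right:
  assumes "\<Sigma> \<in> SPD" "U \<in> Sym" "V \<in> Sym" "V' \<in> Sym"
  shows "wass \<Sigma> U (V + V') = wass \<Sigma> U V + wass \<Sigma> U V'"
  using assms by (simp add: wass_eq_half_trace Sym_add mm.add_right trace_add add_divide_distrib)

lemma wass_diff_right:
  assumes "\<Sigma> \<in> SPD" "U \<in> Sym" "V \<in> Sym" "V' \<in> Sym"
  shows "wass \<Sigma> U (V - V') = wass \<Sigma> U V - wass \<Sigma> U V'"
  using assms by (simp add: wass_eq_half_trace Sym_diff mm.diff_right trace_sub diff_divide_distrib)

lemma wass_diff_left: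
  assumes "\<Sigma> \<in> SPD" "U \<in> Sym" "U' \<in> Sym" "V \<in> Sym"
  shows "wass \<Sigma> (U - U') V = wass \<Sigma> U V - wass \<Sigma> U' V"
  using assms by (simp add: wass_sym[of \<Sigma> _ V] wass_diff_right Sym_diff)

lemma wass_sym_part:
  assumes "\<Sigma> \<in> SPD" "U \<in> Sym"
  shows "wass \<Sigma> U (sym_part A) = trace (lyap \<Sigma> U ** A) / 2"
  using assms by (simp add: wass_eq_half_trace sym_part_Sym trace_mult_sym_part lyap_Sym)

lemma wass_nondegenerate:
  assumes S: "\<Sigma> \<in> SPD" and A: "A \<in> Sym" and B: "B \<in> Sym"
    and eq: "\<And>Z. Z \<in> Sym \<Longrightarrow> wass \<Sigma> A Z = wass \<Sigma> B Z"
  shows "A = B"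
proof -
  have AB: "A - B \<in> Sym"
    using A B by (rule Sym_diff)
  let ?L = "lyap \<Sigma> (A - B)"
  have L: "?L \<in> Sym"
    using S AB by (rule lyap_Sym)
  \<comment> \<open>the test matrix \<open>Z = L\<close> turns the pairing into half the squared Frobenius norm of \<open>L\<close>\<close>
  have "trace (transpose ?L ** ?L) = 2 * wass \<Sigma> (A - B) ?L"
    by (simp add: SymD[OF L] wass_eq_half_trace[OF S AB L])
  also have "\<dots> = 0"
    by (simp add: wass_diff_left S A B L eq)
  finally have "?L = 0"
    by (rule trace_transpose_mult_self_eq_0)
  then show ?thesis
    using lyap_equation[OF S AB] by (simp add: mm.zero_left mm.zero_right)
qed

section \<open>Directional derivatives on the cone\<close>

text \<open>
  The quadratic form of \<open>\<Sigma>\<close> is bounded below by a positive multiple of \<open>\<bar>x\<bar>\<^sup>2\<close>, its minimum on the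
  unit sphere, while that of \<open>V\<close> is bounded by a multiple of \<open>\<bar>x\<bar>\<^sup>2\<close>.
\<close>

lemma SPD_line:
  assumes S: "\<Sigma> \<in> SPD" and V: "V \<in> Sym"
  shows "\<exists>d>0. \<forall>t. \<bar>t\<bar> < d \<longrightarrow> \<Sigma> + t *\<^sub>R V \<in> (SPD :: (real^'n^'n) set)"
proof -
  have "continuous_on (sphere 0 1) (\<lambda>x. x \<bullet> (\<Sigma> *v x))"
    by (intro continuous_intros linear_continuous_on matrix_vector_mul_bounded_linear)
  then obtain x0 where x0: "x0 \<in> sphere 0 1"
    and min: "\<And>x. x \<in> sphere 0 1 \<Longrightarrow> x0 \<bullet> (\<Sigma> *v x0) \<le> x \<bullet> (\<Sigma> *v x)"
    using continuous_attains_inf[of "sphere (0::real^'n) 1" "\<lambda>x. x \<bullet> (\<Sigma> *v x)"] by auto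
  define c where "c = x0 \<bullet> (\<Sigma> *v x0)"
  have c: "c > 0"
  proof -
    have "x0 \<noteq> 0"
      using x0 by auto
    then show ?thesis
      using S by (simp add: c_def SPD_def)
  qed
  obtain K where K: "K > 0" "\<And>x. norm (V *v x) \<le> norm x * K"
    using bounded_linear.pos_bounded[OF matrix_vector_mul_bounded_linear[of V]] by blast
  have "\<Sigma> + t *\<^sub>R V \<in> SPD" if t: "\<bar>t\<bar> < c / K" for t
    unfolding SPD_def
  proof (intro CollectI conjI allI impI)
    show "\<Sigma> + t *\<^sub>R V \<in> Sym"
      using S V by (simp add: Sym_add Sym_scaleR SPD_Sym)
    fix x :: "real^'n"
    assume x: "x \<noteq> 0"
    define u where "u = x /\<^sub>R norm x"
    have u: "x = norm x *\<^sub>R u" "u \<in> sphere 0 1"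
      using x by (simp_all add: u_def)
    have "\<bar>u \<bullet> (V *v u)\<bar> \<le> K"
      using Cauchy_Schwarz_ineq2[of u "V *v u"] K(2)[of u] u(2) by simp
    then have "\<bar>t * (u \<bullet> (V *v u))\<bar> \<le> \<bar>t\<bar> * K"
      by (simp add: abs_mult mult_left_mono)
    also have "\<dots> < c"
      using t K(1) by (simp add: pos_less_divide_eq)
    finally have "0 < u \<bullet> (\<Sigma> *v u) + t * (u \<bullet> (V *v u))"
      using min[OF u(2)] by (simp add: c_def abs_less_iff)
    then have "0 < (norm x)\<^sup>2 * (u \<bullet> ((\<Sigma> + t *\<^sub>R V) *v u))"
      using x
      by (simp add: matrix_vector_mult_add_rdistrib scaleR_matrix_vector_assoc[symmetric]
          inner_add_right)
    also have "\<dots> = (norm x *\<^sub>R u) \<bullet> ((\<Sigma> + t *\<^sub>R V) *v (norm x *\<^sub>R u))"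
      by (simp add: matrix_vector_mult_scaleR power2_eq_square)
    also have "\<dots> = x \<bullet> ((\<Sigma> + t *\<^sub>R V) *v x)"
      by (simp only: u(1)[symmetric])
    finally show "0 < x \<bullet> ((\<Sigma> + t *\<^sub>R V) *v x)" .
  qed
  with c K(1) show ?thesis
    by (intro exI[of _ "c / K"]) simp
qed

lemma has_vector_derivative_dir_deriv:
  fixes f :: "real^'n^'n \<Rightarrow> 'b::real_normed_vector"
  assumes f: "f differentiable (at \<Sigma> within SPD)" and S: "\<Sigma> \<in> SPD" and V: "V \<in> Sym"
  shows "((\<lambda>t. f (\<Sigma> + t *\<^sub>R V)) has_vector_derivative dir_deriv f \<Sigma> V) (at 0)"
proof -
  obtain d where d: "d > 0" "\<And>t. \<bar>t\<bar> < d \<Longrightarrow> \<Sigma> + t *\<^sub>R V \<in> SPD"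
    using SPD_line[OF S V] by blast
  let ?g = "\<lambda>t. \<Sigma> + t *\<^sub>R V" and ?T = "{-d<..<d}"
  obtain f' where f': "(f has_derivative f') (at \<Sigma> within SPD)"
    using f by (auto simp: differentiable_def)
  have g: "(?g has_vector_derivative V) (at 0 within ?T)"
    by (auto intro!: derivative_eq_intros)
  have "?g ` ?T \<subseteq> SPD"
    using d(2) by auto
  then have "(f has_derivative f') (at (?g 0) within ?g ` ?T)"
    using f' by (simp add: has_derivative_subset)
  from vector_derivative_diff_chain_within[OF g this]
  have "((\<lambda>t. f (?g t)) has_vector_derivative f' V) (at 0 within ?T)"
    by (simp only: o_def)
  then have "((\<lambda>t. f (?g t)) has_vector_derivative f' V) (at 0)"
    using d(1) by (subst (asm) has_vector_derivative_within_open) auto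
  then show ?thesis
    unfolding dir_deriv_def by (intro vector_derivative_works[THEN iffD1] differentiableI_vector)
qed

lemma vector_field_Sym: "vector_field X \<Longrightarrow> \<Sigma> \<in> SPD \<Longrightarrow> X \<Sigma> \<in> Sym"
  by (simp add: vector_field_def)

lemma vector_field_differentiable:
  assumes "vector_field X" "\<Sigma> \<in> SPD"
  shows "X differentiable (at \<Sigma> within SPD)"
proof -
  have "Ck_on_SPD (Suc 0) X"
    using assms(1) unfolding vector_field_def smooth_on_SPD_def by blast
  with assms(2) show ?thesis
    by simp
qed

lemma vector_field_const:
  fixes Z :: "real^'n^'n"
  assumes "Z \<in> Sym"
  shows "vector_field (\<lambda>_. Z)"
proof -
  have "Ck_on_SPD k (\<lambda>_ :: real^'n^'n. C)" for k and C :: "real^'n^'n"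
    by (induction k arbitrary: C) (simp_all add: dir_deriv_def)
  with assms show ?thesis
    by (simp add: vector_field_def smooth_on_SPD_def)
qed

lemma vector_field_has_vector_derivative:
  assumes "vector_field X" "vector_field Y" "\<Sigma> \<in> SPD"
  shows "((\<lambda>t. Y (\<Sigma> + t *\<^sub>R X \<Sigma>)) has_vector_derivative dfield X Y \<Sigma>) (at 0)"
  unfolding dfield_def using assms
  by (intro has_vector_derivative_dir_deriv vector_field_differentiable vector_field_Sym)

lemma dfield_Sym:
  assumes X: "vector_field X" and Y: "vector_field Y" and S: "\<Sigma> \<in> SPD"
  shows "dfield X Y \<Sigma> \<in> Sym"
proof -
  obtain d where d: "d > 0" "\<And>t. \<bar>t\<bar> < d \<Longrightarrow> \<Sigma> + t *\<^sub>R X \<Sigma> \<in> SPD"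
    using SPD_line[OF S vector_field_Sym[OF X S]] by blast
  have Y': "((\<lambda>t. Y (\<Sigma> + t *\<^sub>R X \<Sigma>)) has_vector_derivative dfield X Y \<Sigma>) (at 0)"
    using assms by (rule vector_field_has_vector_derivative)
  have "((\<lambda>t. Y (\<Sigma> + t *\<^sub>R X \<Sigma>)) has_vector_derivative transpose (dfield X Y \<Sigma>)) (at 0)"
    using bounded_linear.has_vector_derivative[OF bounded_linear_transpose Y'] d(1)
    by (rule has_vector_derivative_transform_within)
       (auto simp: dist_real_def d(2) SymD vector_field_Sym[OF Y])
  from vector_derivative_unique_at[OF Y' this] show ?thesis
    unfolding Sym_def by simp
qed

section \<open>The derivative of the metric\<close>

text \<open>
  Once \<open>\<bar>t\<bar> \<parallel>R\<parallel> \<le> 1/2\<close>, the implicit equation bounds \<open>L t\<close> by \<open>2 \<parallel>F t\<parallel>\<close>; fed back into the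
  equation this bound gives continuity of \<open>L\<close>, and continuity in turn gives the derivative of the
  term \<open>t R (L t)\<close>.
\<close>

lemma has_vector_derivative_implicit_linear:
  fixes L F :: "real \<Rightarrow> 'a::real_normed_vector"
  assumes R: "bounded_linear R" and F: "(F has_vector_derivative F') (at 0)" and d: "d > 0"
    and eq: "\<And>t. \<bar>t\<bar> < d \<Longrightarrow> L t = F t - t *\<^sub>R R (L t)"
  shows "(L has_vector_derivative F' - R (F 0)) (at 0)"
proof -
  interpret R: bounded_linear R
    by (rule R)
  obtain K where K: "K > 0" "\<And>x. norm (R x) \<le> norm x * K"
    using R.pos_bounded by blast
  have F0: "(F \<longlongrightarrow> F 0) (at 0)"
    using has_vector_derivative_continuous[OF F] by (simp add: isCont_def)
  define d' where "d' = min d (1 / (2 * K))"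
  have d': "d' > 0"
    using d K by (simp add: d'_def)
  have bound: "norm (L t - F t) \<le> \<bar>t\<bar> * (2 * norm (F t) * K)" if t: "\<bar>t\<bar> < d'" for t
  proof -
    have eq_t: "L t = F t - t *\<^sub>R R (L t)"
      using t by (intro eq) (simp add: d'_def)
    then have diff: "norm (L t - F t) = \<bar>t\<bar> * norm (R (L t))"
      by (metis add_diff_cancel_left' diff_add_cancel minus_diff_eq norm_minus_cancel norm_scaleR)
    also have "\<dots> \<le> \<bar>t\<bar> * (norm (L t) * K)"
      by (intro mult_left_mono K(2)) simp
    finally have 1: "norm (L t - F t) \<le> \<bar>t\<bar> * (norm (L t) * K)" .
    have "\<bar>t\<bar> * K \<le> 1 / 2"
      using t K(1) by (simp add: d'_def field_simps)
    then have "\<bar>t\<bar> * K * norm (L t) \<le> 1 / 2 * norm (L t)"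
      by (rule mult_right_mono) simp
    then have "norm (L t) \<le> 2 * norm (F t)"
      using 1 norm_triangle_ineq2[of "L t" "F t"] by (simp add: mult.commute mult.left_commute)
    then have "\<bar>t\<bar> * (norm (L t) * K) \<le> \<bar>t\<bar> * (2 * norm (F t) * K)"
      using K(1) by (intro mult_left_mono mult_right_mono) simp_all
    with 1 show ?thesis
      by linarith
  qed
  have "((\<lambda>t. L t - F t) \<longlongrightarrow> 0) (at 0)"
  proof (rule Lim_null_comparison)
    show "\<forall>\<^sub>F t in at 0. norm (L t - F t) \<le> \<bar>t\<bar> * (2 * norm (F t) * K)"
      unfolding eventually_at using d' bound by (auto simp: dist_real_def)
    have "((\<lambda>t. \<bar>t\<bar> * (2 * norm (F t) * K)) \<longlongrightarrow> \<bar>0\<bar> * (2 * norm (F 0) * K)) (at 0)"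
      by (intro tendsto_intros F0)
    then show "((\<lambda>t. \<bar>t\<bar> * (2 * norm (F t) * K)) \<longlongrightarrow> 0) (at 0)"
      by simp
  qed
  from tendsto_add[OF this F0] have L0: "(L \<longlongrightarrow> F 0) (at 0)"
    by simp
  have "((\<lambda>t. t *\<^sub>R R (L t)) has_vector_derivative R (F 0)) (at 0)"
    unfolding has_vector_derivative_def has_derivative_iff_norm
  proof
    have "((\<lambda>t. norm (R (L t) - R (F 0))) \<longlongrightarrow> 0) (at 0)"
      using R.tendsto[OF L0] by (simp add: LIM_zero_iff tendsto_norm_zero_iff)
    then show "((\<lambda>t. norm (t *\<^sub>R R (L t) - 0 *\<^sub>R R (L 0) - (t - 0) *\<^sub>R R (F 0)) / norm (t - 0))
        \<longlongrightarrow> 0) (at 0)"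
      by (rule Lim_transform_eventually)
         (simp add: eventually_at_filter flip: scaleR_diff_right)
  qed (rule bounded_linear_scaleR_left)
  with F have "((\<lambda>t. F t - t *\<^sub>R R (L t)) has_vector_derivative F' - R (F 0)) (at 0)"
    by (rule has_vector_derivative_diff)
  then show ?thesis
    using d by (rule has_vector_derivative_transform_within) (simp_all add: dist_real_def eq[symmetric])
qed

text \<open>
  Along the line, \<open>L t\<close> solves the Lyapunov equation at \<open>\<Sigma> + t X\<close>. Moving the terms with
  \<open>t\<close> to the right gives a Lyapunov equation at the fixed point \<open>\<Sigma>\<close>, namely
  \<open>L t = lyap \<Sigma> (V t) - t lyap \<Sigma> (L t X + X L t)\<close>, which is of the implicit linear form.
\<close>

lemma lyap_has_vector_derivative:
  assumes S: "\<Sigma> \<in> SPD" and X: "X \<in> Sym" and d: "d > 0"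
    and V: "\<And>t. \<bar>t\<bar> < d \<Longrightarrow> V t \<in> Sym"
    and V': "(V has_vector_derivative V') (at 0)" "V' \<in> Sym"
  shows "((\<lambda>t. lyap (\<Sigma> + t *\<^sub>R X) (V t)) has_vector_derivative
           lyap \<Sigma> V' - lyap \<Sigma> (lyap \<Sigma> (V 0) ** X + X ** lyap \<Sigma> (V 0))) (at 0)"
proof -
  let ?G = "\<lambda>A. lyap \<Sigma> (sym_part A)"
  interpret G: bounded_linear ?G
    by (rule bounded_linear_lyap_sym_part[OF S])
  let ?R = "\<lambda>A. ?G (A ** X + X ** A)" and ?L = "\<lambda>t. lyap (\<Sigma> + t *\<^sub>R X) (V t)"
  have G_Sym: "?G A = lyap \<Sigma> A" if "A \<in> Sym" for A
    using that by (simp add: sym_part_ident)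
  have anticomm_Sym: "A ** X + X ** A \<in> Sym" if "A \<in> Sym" for A
    using that X by (simp add: Sym_def transpose_add matrix_transpose_mul add.commute)
  obtain d1 where d1: "d1 > 0" "\<And>t. \<bar>t\<bar> < d1 \<Longrightarrow> \<Sigma> + t *\<^sub>R X \<in> SPD"
    using SPD_line[OF S X] by blast
  have V0: "V 0 \<in> Sym"
    using V[of 0] d by simp
  have "(?L has_vector_derivative ?G V' - ?R (?G (V 0))) (at 0)"
  proof (rule has_vector_derivative_implicit_linear[where R = ?R and F = "\<lambda>t. ?G (V t)"])
    show "bounded_linear ?R"
      by (intro G.bounded_linear_axioms[THEN bounded_linear_compose] bounded_linear_add
          mm.bounded_linear_left mm.bounded_linear_right)
    show "((\<lambda>t. ?G (V t)) has_vector_derivative ?G V') (at 0)"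
      by (rule G.has_vector_derivative[OF V'(1)])
    show "min d d1 > 0"
      using d d1 by simp
    fix t :: real
    assume t: "\<bar>t\<bar> < min d d1"
    have L: "?L t \<in> Sym" "?L t ** (\<Sigma> + t *\<^sub>R X) + (\<Sigma> + t *\<^sub>R X) ** ?L t = V t"
      using t d1 V by (simp_all add: lyap_Sym lyap_equation)
    then have "?L t ** \<Sigma> + \<Sigma> ** ?L t = V t - t *\<^sub>R (?L t ** X + X ** ?L t)"
      by (simp add: mm.add_left mm.add_right mm.scaleR_left mm.scaleR_right algebra_simps)
    from lyap_eqI[OF S L(1) this]
    have "?L t = ?G (V t - t *\<^sub>R (?L t ** X + X ** ?L t))"
      using t V L(1) by (simp add: G_Sym Sym_diff Sym_scaleR anticomm_Sym)
    then show "?L t = ?G (V t) - t *\<^sub>R ?R (?L t)"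
      by (simp add: G.diff G.scaleR)
  qed
  then show ?thesis
    by (simp add: G_Sym V0 V'(2) anticomm_Sym lyap_Sym S)
qed

text \<open>
  Expanding \<open>\<langle>Y,Z\<rangle> = Tr (L\<^sub>Y Z) / 2\<close>, the contribution of the moving base point is
  \<open>- Tr (lyap \<Sigma> (L\<^sub>Y X + X L\<^sub>Y) Z) / 2\<close>. Symmetry of the form moves \<open>lyap \<Sigma>\<close> onto \<open>Z\<close>, and the two
  resulting traces agree by transposition.
\<close>

lemma dfield_wass:
  assumes X: "vector_field X" and Y: "vector_field Y" and Z: "vector_field Z" and S: "\<Sigma> \<in> SPD"
  shows "dfield X (\<lambda>\<Sigma>. wass \<Sigma> (Y \<Sigma>) (Z \<Sigma>)) \<Sigma> =
    wass \<Sigma> (dfield X Y \<Sigma>) (Z \<Sigma>) + wass \<Sigma> (Y \<Sigma>) (dfield X Z \<Sigma>)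
    - trace (lyap \<Sigma> (Y \<Sigma>) ** X \<Sigma> ** lyap \<Sigma> (Z \<Sigma>))"
proof -
  let ?s = "\<lambda>t. \<Sigma> + t *\<^sub>R X \<Sigma>" and ?K = "lyap \<Sigma> (Y \<Sigma>)" and ?L = "lyap \<Sigma> (Z \<Sigma>)"
  let ?A = "?K ** X \<Sigma> + X \<Sigma> ** ?K"
  have sym: "X \<Sigma> \<in> Sym" "Y \<Sigma> \<in> Sym" "Z \<Sigma> \<in> Sym" "dfield X Y \<Sigma> \<in> Sym" "dfield X Z \<Sigma> \<in> Sym"
    using assms by (simp_all add: vector_field_Sym dfield_Sym)
  have K: "?K \<in> Sym" and L: "?L \<in> Sym"
    using S sym by (simp_all add: lyap_Sym)
  have A: "?A \<in> Sym"
    using K sym(1) by (simp add: Sym_def transpose_add matrix_transpose_mul add.commute)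
  obtain d where d: "d > 0" "\<And>t. \<bar>t\<bar> < d \<Longrightarrow> ?s t \<in> SPD"
    using SPD_line[OF S sym(1)] by blast
  have "((\<lambda>t. lyap (?s t) (Y (?s t))) has_vector_derivative lyap \<Sigma> (dfield X Y \<Sigma>) - lyap \<Sigma> ?A) (at 0)"
    using lyap_has_vector_derivative[OF S sym(1) d(1) _ vector_field_has_vector_derivative[OF X Y S]]
    by (simp add: vector_field_Sym[OF Y] d(2) sym)
  from mm.has_vector_derivative[OF this vector_field_has_vector_derivative[OF X Z S],
      THEN bounded_linear.has_vector_derivative[OF bounded_linear_trace],
      THEN bounded_linear.has_vector_derivative[OF bounded_linear_divide[of 2]]]
  have "((\<lambda>t. trace (lyap (?s t) (Y (?s t)) ** Z (?s t)) / 2) has_vector_derivative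
      trace (?K ** dfield X Z \<Sigma> + (lyap \<Sigma> (dfield X Y \<Sigma>) - lyap \<Sigma> ?A) ** Z \<Sigma>) / 2) (at 0)"
    by simp
  then have "((\<lambda>t. wass (?s t) (Y (?s t)) (Z (?s t))) has_vector_derivative
      trace (?K ** dfield X Z \<Sigma> + (lyap \<Sigma> (dfield X Y \<Sigma>) - lyap \<Sigma> ?A) ** Z \<Sigma>) / 2) (at 0)"
    using d(1)
    by (rule has_vector_derivative_transform_within)
       (simp_all add: dist_real_def wass_eq_half_trace d(2) vector_field_Sym[OF Y] vector_field_Sym[OF Z])
  then have "dfield X (\<lambda>\<Sigma>. wass \<Sigma> (Y \<Sigma>) (Z \<Sigma>)) \<Sigma> =
      trace (?K ** dfield X Z \<Sigma> + (lyap \<Sigma> (dfield X Y \<Sigma>) - lyap \<Sigma> ?A) ** Z \<Sigma>) / 2"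
    unfolding dfield_def dir_deriv_def by (rule vector_derivative_at)
  also have "\<dots> = wass \<Sigma> (dfield X Y \<Sigma>) (Z \<Sigma>) + wass \<Sigma> (Y \<Sigma>) (dfield X Z \<Sigma>) - wass \<Sigma> ?A (Z \<Sigma>)"
    by (simp add: wass_eq_half_trace S sym A mm.diff_left trace_add trace_sub
        add_divide_distrib diff_divide_distrib)
  also have "wass \<Sigma> ?A (Z \<Sigma>) = trace (?L ** ?A) / 2"
    unfolding wass_sym[OF S A sym(3)] by (rule wass_eq_half_trace[OF S sym(3) A])
  also have "\<dots> = (trace (?L ** ?K ** X \<Sigma>) + trace (?L ** X \<Sigma> ** ?K)) / 2"
    by (simp add: mm.add_right trace_add matrix_mul_assoc)
  also have "trace (?L ** ?K ** X \<Sigma>) = trace (?K ** X \<Sigma> ** ?L)"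
    by (rule trace_cycle3)
  also have "trace (?L ** X \<Sigma> ** ?K) = trace (?K ** X \<Sigma> ** ?L)"
    using L sym(1) K by (rule trace_reverse3)
  finally show ?thesis
    by simp
qed

section \<open>The Levi-Civita derivative\<close>

text \<open>
  The three unknowns are \<open>\<langle>e(X,Y),Z\<rangle>\<close>, \<open>\<langle>e(Y,Z),X\<rangle>\<close> and \<open>\<langle>e(Z,X),Y\<rangle>\<close> with \<open>e(X,Y) = D\<^sub>X Y - d\<^sub>X Y\<close>
  symmetric; compatibility for the three cyclic permutations gives their pairwise sums.
\<close>

lemma koszul_wass:
  assumes D: "levi_civita D"
    and X: "vector_field X" and Y: "vector_field Y" and Z: "vector_field Z" and S: "\<Sigma> \<in> SPD"
  shows "wass \<Sigma> (D X Y \<Sigma>) (Z \<Sigma>) = wass \<Sigma> (dfield X Y \<Sigma>) (Z \<Sigma>)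
    + trace (lyap \<Sigma> (X \<Sigma>) ** Z \<Sigma> ** lyap \<Sigma> (Y \<Sigma>)) / 2
    - trace (lyap \<Sigma> (X \<Sigma>) ** Y \<Sigma> ** lyap \<Sigma> (Z \<Sigma>)) / 2
    - trace (lyap \<Sigma> (Y \<Sigma>) ** X \<Sigma> ** lyap \<Sigma> (Z \<Sigma>)) / 2"
proof -
  define e where "e X Y = D X Y \<Sigma> - dfield X Y \<Sigma>" for X Y
  have DXY: "vector_field (D P Q)" if "vector_field P" "vector_field Q" for P Q
    using D that unfolding levi_civita_def covariant_derivative_def by blast
  have sym: "D P Q \<Sigma> \<in> Sym" "dfield P Q \<Sigma> \<in> Sym" if "vector_field P" "vector_field Q" for P Q
    using that S by (simp_all add: DXY vector_field_Sym dfield_Sym)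
  have e_sym: "e P Q = e Q P" if "vector_field P" "vector_field Q" for P Q
  proof -
    have "D P Q \<Sigma> - D Q P \<Sigma> = dfield P Q \<Sigma> - dfield Q P \<Sigma>"
      using D that S unfolding levi_civita_def torsion_free_def eq_on_SPD_def by blast
    then show ?thesis
      by (simp add: e_def algebra_simps)
  qed
  have e_compat: "wass \<Sigma> (e P Q) (R \<Sigma>) + wass \<Sigma> (e P R) (Q \<Sigma>)
      = - trace (lyap \<Sigma> (Q \<Sigma>) ** P \<Sigma> ** lyap \<Sigma> (R \<Sigma>))"
    if "vector_field P" "vector_field Q" "vector_field R" for P Q R
  proof -
    have "dfield P (\<lambda>\<Sigma>. wass \<Sigma> (Q \<Sigma>) (R \<Sigma>)) \<Sigma>
        = wass \<Sigma> (D P Q \<Sigma>) (R \<Sigma>) + wass \<Sigma> (Q \<Sigma>) (D P R \<Sigma>)"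
      using D that S unfolding levi_civita_def metric_compatible_def eq_on_SPD_def by blast
    then show ?thesis
      using dfield_wass[OF that S] that S
      by (simp add: e_def wass_diff_left sym vector_field_Sym wass_sym[of \<Sigma> "Q \<Sigma>"])
  qed
  have tr_rev: "trace (lyap \<Sigma> (P \<Sigma>) ** Q \<Sigma> ** lyap \<Sigma> (R \<Sigma>))
      = trace (lyap \<Sigma> (R \<Sigma>) ** Q \<Sigma> ** lyap \<Sigma> (P \<Sigma>))"
    if "vector_field P" "vector_field Q" "vector_field R" for P Q R
    using that S by (intro trace_reverse3) (simp_all add: lyap_Sym vector_field_Sym)
  have "wass \<Sigma> (e X Y) (Z \<Sigma>) = trace (lyap \<Sigma> (X \<Sigma>) ** Z \<Sigma> ** lyap \<Sigma> (Y \<Sigma>)) / 2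
    - trace (lyap \<Sigma> (X \<Sigma>) ** Y \<Sigma> ** lyap \<Sigma> (Z \<Sigma>)) / 2
    - trace (lyap \<Sigma> (Y \<Sigma>) ** X \<Sigma> ** lyap \<Sigma> (Z \<Sigma>)) / 2"
    using e_compat[OF X Y Z] e_compat[OF Y Z X] e_compat[OF Z X Y]
      e_sym[OF X Y] e_sym[OF Y Z] e_sym[OF Z X] tr_rev[OF Z Y X]
    by simp
  then show ?thesis
    using assms by (simp add: e_def wass_diff_left sym vector_field_Sym)
qed

text \<open>
  The term \<open>Tr (L\<^sub>X Z L\<^sub>Y)\<close> has \<open>Z\<close> itself between the factors rather than \<open>L\<^sub>Z\<close> at the end. Inserting
  the Lyapunov equation for \<open>Z\<close> there turns it into two traces in which \<open>L\<^sub>Z\<close> can be cycled to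
  the front, and \<open>\<Sigma>\<close> stays behind.
\<close>

lemma trace_lyap_middle:
  assumes S: "\<Sigma> \<in> SPD" and X: "X \<in> Sym" and Y: "Y \<in> Sym" and Z: "Z \<in> Sym"
  shows "trace (lyap \<Sigma> X ** Z ** lyap \<Sigma> Y)
    = trace (lyap \<Sigma> Z ** (\<Sigma> ** lyap \<Sigma> X ** lyap \<Sigma> Y + \<Sigma> ** lyap \<Sigma> Y ** lyap \<Sigma> X))"
proof -
  let ?A = "lyap \<Sigma> X" and ?B = "lyap \<Sigma> Y" and ?C = "lyap \<Sigma> Z"
  have sym: "?A \<in> Sym" "?B \<in> Sym" "?C \<in> Sym" "\<Sigma> \<in> Sym"
    using assms by (simp_all add: lyap_Sym SPD_Sym)
  have "trace (?A ** Z ** ?B) = trace (?A ** (?C ** \<Sigma> + \<Sigma> ** ?C) ** ?B)"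
    by (simp add: lyap_equation[OF S Z])
  also have "\<dots> = trace (?A ** (?C ** \<Sigma>) ** ?B) + trace (?A ** (\<Sigma> ** ?C) ** ?B)"
    by (simp add: mm.add_left mm.add_right trace_add)
  also have "trace (?A ** (?C ** \<Sigma>) ** ?B) = trace (?C ** (\<Sigma> ** ?B ** ?A))"
    using trace_cycle3[of ?A "?C ** \<Sigma>" ?B] by (simp add: matrix_mul_assoc)
  also have "trace (?A ** (\<Sigma> ** ?C) ** ?B) = trace (?B ** (?C ** \<Sigma>) ** ?A)"
    using sym trace_transpose[of "?A ** (\<Sigma> ** ?C) ** ?B"]
    by (simp add: matrix_transpose_mul SymD matrix_mul_assoc)
  also have "\<dots> = trace (?C ** (\<Sigma> ** ?A ** ?B))"
    using trace_cycle3[of ?B "?C ** \<Sigma>" ?A] by (simp add: matrix_mul_assoc)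
  finally show ?thesis
    by (simp add: mm.add_right trace_add)
qed

theorem proposition13:
  fixes D :: "(real^'n^'n \<Rightarrow> real^'n^'n) \<Rightarrow> (real^'n^'n \<Rightarrow> real^'n^'n) \<Rightarrow> (real^'n^'n \<Rightarrow> real^'n^'n)"
    and X Y :: "real^'n^'n \<Rightarrow> real^'n^'n"
  assumes "levi_civita D"
    and "vector_field X" and "vector_field Y"
  shows
    "(\<forall>Z. vector_field Z \<longrightarrow> (\<forall>\<Sigma>\<in>SPD.
        wass \<Sigma> (D X Y \<Sigma>) (Z \<Sigma>) =
          wass \<Sigma> (dfield X Y \<Sigma>) (Z \<Sigma>)
          + wass \<Sigma> (X \<Sigma>) (sym_part (lyap \<Sigma> (Y \<Sigma>) ** Z \<Sigma>))
          - wass \<Sigma> (X \<Sigma>) (sym_part (lyap \<Sigma> (Z \<Sigma>) ** Y \<Sigma>))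
          - wass \<Sigma> (Y \<Sigma>) (sym_part (lyap \<Sigma> (Z \<Sigma>) ** X \<Sigma>)) \<and>
        wass \<Sigma> (D X Y \<Sigma>) (Z \<Sigma>) =
          wass \<Sigma> (dfield X Y \<Sigma>) (Z \<Sigma>)
          + (1/2) * trace (lyap \<Sigma> (X \<Sigma>) ** Z \<Sigma> ** lyap \<Sigma> (Y \<Sigma>))
          - (1/2) * trace (lyap \<Sigma> (X \<Sigma>) ** Y \<Sigma> ** lyap \<Sigma> (Z \<Sigma>))
          - (1/2) * trace (lyap \<Sigma> (Y \<Sigma>) ** X \<Sigma> ** lyap \<Sigma> (Z \<Sigma>)))) \<and>
     (\<forall>W. vector_field W \<longrightarrow>
        (\<forall>Z. vector_field Z \<longrightarrow> (\<forall>\<Sigma>\<in>SPD.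
          wass \<Sigma> (W \<Sigma>) (Z \<Sigma>) =
            wass \<Sigma> (dfield X Y \<Sigma>) (Z \<Sigma>)
            + wass \<Sigma> (X \<Sigma>) (sym_part (lyap \<Sigma> (Y \<Sigma>) ** Z \<Sigma>))
            - wass \<Sigma> (X \<Sigma>) (sym_part (lyap \<Sigma> (Z \<Sigma>) ** Y \<Sigma>))
            - wass \<Sigma> (Y \<Sigma>) (sym_part (lyap \<Sigma> (Z \<Sigma>) ** X \<Sigma>)))) \<longrightarrow>
        (\<forall>\<Sigma>\<in>SPD. W \<Sigma> = D X Y \<Sigma>)) \<and>
     (\<forall>\<Sigma>\<in>SPD.
        D X Y \<Sigma> =
          dfield X Y \<Sigma>
          - sym_part (lyap \<Sigma> (X \<Sigma>) ** Y \<Sigma> + lyap \<Sigma> (Y \<Sigma>) ** X \<Sigma>)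
          + sym_part (\<Sigma> ** lyap \<Sigma> (X \<Sigma>) ** lyap \<Sigma> (Y \<Sigma>)
                      + \<Sigma> ** lyap \<Sigma> (Y \<Sigma>) ** lyap \<Sigma> (X \<Sigma>)))"
proof -
  have D: "vector_field (D X Y)"
    using assms unfolding levi_civita_def covariant_derivative_def by blast
  have sym: "X \<Sigma> \<in> Sym" "Y \<Sigma> \<in> Sym" "D X Y \<Sigma> \<in> Sym" "dfield X Y \<Sigma> \<in> Sym" if "\<Sigma> \<in> SPD" for \<Sigma>
    using that assms D by (simp_all add: vector_field_Sym dfield_Sym)
  let ?rhs1 = "\<lambda>Z \<Sigma>. wass \<Sigma> (dfield X Y \<Sigma>) (Z \<Sigma>)
    + wass \<Sigma> (X \<Sigma>) (sym_part (lyap \<Sigma> (Y \<Sigma>) ** Z \<Sigma>))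
    - wass \<Sigma> (X \<Sigma>) (sym_part (lyap \<Sigma> (Z \<Sigma>) ** Y \<Sigma>))
    - wass \<Sigma> (Y \<Sigma>) (sym_part (lyap \<Sigma> (Z \<Sigma>) ** X \<Sigma>))"
  let ?rhs2 = "\<lambda>Z \<Sigma>. wass \<Sigma> (dfield X Y \<Sigma>) (Z \<Sigma>)
    + (1/2) * trace (lyap \<Sigma> (X \<Sigma>) ** Z \<Sigma> ** lyap \<Sigma> (Y \<Sigma>))
    - (1/2) * trace (lyap \<Sigma> (X \<Sigma>) ** Y \<Sigma> ** lyap \<Sigma> (Z \<Sigma>))
    - (1/2) * trace (lyap \<Sigma> (Y \<Sigma>) ** X \<Sigma> ** lyap \<Sigma> (Z \<Sigma>))"
  let ?expl = "\<lambda>\<Sigma>. dfield X Y \<Sigma>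
    - sym_part (lyap \<Sigma> (X \<Sigma>) ** Y \<Sigma> + lyap \<Sigma> (Y \<Sigma>) ** X \<Sigma>)
    + sym_part (\<Sigma> ** lyap \<Sigma> (X \<Sigma>) ** lyap \<Sigma> (Y \<Sigma>) + \<Sigma> ** lyap \<Sigma> (Y \<Sigma>) ** lyap \<Sigma> (X \<Sigma>))"
  have second: "wass \<Sigma> (D X Y \<Sigma>) (Z \<Sigma>) = ?rhs2 Z \<Sigma>" if "vector_field Z" "\<Sigma> \<in> SPD" for Z \<Sigma>
    using koszul_wass[OF assms that] by simp
  have rhs_eq: "?rhs1 Z \<Sigma> = ?rhs2 Z \<Sigma>" if Z: "vector_field Z" and S: "\<Sigma> \<in> SPD" for Z \<Sigma>
  proof -
    have pair: "wass \<Sigma> U (sym_part (lyap \<Sigma> V ** W)) = trace (lyap \<Sigma> U ** W ** lyap \<Sigma> V) / 2"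
      if "U \<in> Sym" "V \<in> Sym" "W \<in> Sym" for U V W
    proof -
      have "trace (lyap \<Sigma> U ** lyap \<Sigma> V ** W) = trace (W ** lyap \<Sigma> V ** lyap \<Sigma> U)"
        using that S by (intro trace_reverse3 lyap_Sym)
      also have "\<dots> = trace (lyap \<Sigma> U ** W ** lyap \<Sigma> V)"
        by (rule trace_cycle3[symmetric])
      finally show ?thesis
        using that S by (simp add: wass_sym_part matrix_mul_assoc)
    qed
    show ?thesis
      using Z S by (simp add: pair sym vector_field_Sym)
  qed
  have first: "wass \<Sigma> (D X Y \<Sigma>) (Z \<Sigma>) = ?rhs1 Z \<Sigma>" if "vector_field Z" "\<Sigma> \<in> SPD" for Z \<Sigma>
    using second[OF that] rhs_eq[OF that] by simp
  \<comment> \<open>constant fields realise every symmetric matrix as a value, so nondegeneracy applies pointwise\<close>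
  have implicit: "W \<Sigma> = D X Y \<Sigma>"
    if W: "vector_field W" and S: "\<Sigma> \<in> SPD"
      and eq: "\<forall>Z. vector_field Z \<longrightarrow> (\<forall>\<Sigma>\<in>SPD. wass \<Sigma> (W \<Sigma>) (Z \<Sigma>) = ?rhs1 Z \<Sigma>)" for W \<Sigma>
  proof (rule wass_nondegenerate[OF S])
    show "W \<Sigma> \<in> Sym" "D X Y \<Sigma> \<in> Sym"
      using W S by (simp_all add: vector_field_Sym sym)
    fix Z :: "real^'n^'n"
    assume "Z \<in> Sym"
    then have Z: "vector_field (\<lambda>_. Z)"
      by (rule vector_field_const)
    show "wass \<Sigma> (W \<Sigma>) Z = wass \<Sigma> (D X Y \<Sigma>) Z"
      using eq[rule_format, OF Z S] first[OF Z S] by simp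
  qed
  have explicit: "D X Y \<Sigma> = ?expl \<Sigma>" if S: "\<Sigma> \<in> SPD" for \<Sigma>
  proof (rule wass_nondegenerate[OF S])
    show "D X Y \<Sigma> \<in> Sym" and expl: "?expl \<Sigma> \<in> Sym"
      using S by (auto intro!: sym Sym_add Sym_diff sym_part_Sym)
    fix Z :: "real^'n^'n"
    assume Z: "Z \<in> Sym"
    have cyc: "trace (lyap \<Sigma> Z ** lyap \<Sigma> U ** V) = trace (lyap \<Sigma> U ** V ** lyap \<Sigma> Z)" for U V
      by (rule trace_cycle3)
    have "wass \<Sigma> (?expl \<Sigma>) Z = wass \<Sigma> Z (?expl \<Sigma>)"
      using S expl Z by (rule wass_sym)
    also have "\<dots> = wass \<Sigma> (dfield X Y \<Sigma>) Z
        - trace (lyap \<Sigma> Z ** (lyap \<Sigma> (X \<Sigma>) ** Y \<Sigma> + lyap \<Sigma> (Y \<Sigma>) ** X \<Sigma>)) / 2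
        + trace (lyap \<Sigma> (X \<Sigma>) ** Z ** lyap \<Sigma> (Y \<Sigma>)) / 2"
      using S Z
      by (simp add: wass_add_right wass_diff_right Sym_diff sym sym_part_Sym wass_sym_part
          trace_lyap_middle wass_sym[of \<Sigma> Z "dfield X Y \<Sigma>"])
    also have "\<dots> = ?rhs2 (\<lambda>_. Z) \<Sigma>"
      by (simp add: mm.add_right trace_add matrix_mul_assoc cyc field_simps)
    also have "\<dots> = wass \<Sigma> (D X Y \<Sigma>) Z"
      using second[OF vector_field_const[OF Z] S] by simp
    finally show "wass \<Sigma> (D X Y \<Sigma>) Z = wass \<Sigma> (?expl \<Sigma>) Z"
      by simp
  qed
  show ?thesis
    using first second implicit explicit by blast
qed

end
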